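(* Let $n \in \omega$ be a natural number and let $(X, \mathcal{T})$ be any Hausdorff space with $|X| = \aleph_n$. Then there is a coloring $c : [X]^{n+2} \to \omega$ such that for every subspace $R \subseteq X$ that is homeomorphic to $\mathbb{Q}$ (with its usual topology), $c''[R]^{n+2} = \omega$.
   Context: For a set $Y$ and a cardinal $\kappa$, $[Y]^{\kappa}$ denotes the set of all subsets of $Y$ of cardinality $\kappa$. For a function $c$ and $Y \subseteq \mathrm{dom}(c)$, $c''Y = \{c(y) : y \in Y\}$ is the image of $Y$ under $c$. Here $\omega = \{0,1,2,\dots\}$. *)

theory Defs
  imports "HOL-Analysis.Analysis" "HOL-Library.Ramsey"
begin

no_notation elt_set_eq (infix \<open>=o\<close> 50)
unbundle cardinal_syntax

text \<open>
  \<open>has_card_aleph n A\<close> says \<open>|A| = \<aleph>\<^sub>n\<close>. The operation \<^const>\<open>cardSuc\<close> changes the type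
  (it maps \<open>'a rel\<close> to \<open>'a set rel\<close>), so \<open>\<aleph>\<^sub>n\<close> cannot be obtained by iterating it along \<open>n\<close> inside
  one type. The recursion instead uses a subset \<open>B\<close> of \<open>A\<close> to represent the preceding cardinal;
  such a \<open>B\<close> exists whenever \<open>|A| = \<aleph>\<^bsub>n+1\<^esub>\<close>.
\<close>

primrec has_card_aleph :: "nat \<Rightarrow> 'a set \<Rightarrow> bool" where
  "has_card_aleph 0 A \<longleftrightarrow> |A| =o natLeq"
| "has_card_aleph (Suc n) A \<longleftrightarrow> (\<exists>B\<subseteq>A. has_card_aleph n B \<and> |A| =o cardSuc |B| )"

lemma has_card_aleph_unique:
  fixes A :: "'a set" and B :: "'b set"
  assumes "has_card_aleph n A" "has_card_aleph n B"
  shows "|A| =o |B|"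
  using assms
proof (induction n arbitrary: A B)
  case 0
  then have "|A| =o natLeq" "|B| =o natLeq"
    by simp_all
  then show ?case
    by (rule ordIso_transitive[OF _ ordIso_symmetric])
next
  case (Suc n)
  then obtain A' :: "'a set" and B' :: "'b set" where *: "has_card_aleph n A'" "|A| =o cardSuc |A'|"
      "has_card_aleph n B'" "|B| =o cardSuc |B'|"
    by auto
  then have "cardSuc |A'| =o cardSuc |B'|"
    using Suc.IH by (simp add: cardSuc_invar_ordIso card_of_Card_order)
  then show ?case
    by (rule ordIso_transitive[OF ordIso_transitive[OF *(2)] ordIso_symmetric[OF *(4)]])
qed

lemma has_card_aleph_cong:
  fixes A :: "'a set" and B :: "'b set"
  assumes "has_card_aleph n A" "|A| =o |B|"
  shows "has_card_aleph n B"
  using assms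
proof (induction n arbitrary: A B)
  case 0
  then have "|A| =o natLeq"
    by simp
  then have "|B| =o natLeq"
    by (rule ordIso_transitive[OF ordIso_symmetric[OF \<open>|A| =o |B|\<close>]])
  then show ?case
    by simp
next
  case (Suc n)
  then obtain A' where A': "A' \<subseteq> A" "has_card_aleph n A'" "|A| =o cardSuc |A'|"
    by auto
  have "|A'| \<le>o |B|"
    by (rule ordLeq_ordIso_trans[OF card_of_mono1[OF A'(1)] Suc.prems(2)])
  then obtain B' where B': "B' \<subseteq> B" "|A'| =o |B'|"
    unfolding internalize_card_of_ordLeq2[of A' B] by auto
  have "cardSuc |A'| =o cardSuc |B'|"
    using B'(2) by (simp add: cardSuc_invar_ordIso card_of_Card_order)
  then have "|B| =o cardSuc |B'|"
    by (rule ordIso_transitive[OF ordIso_transitive[OF ordIso_symmetric[OF Suc.prems(2)] A'(3)]])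
  then show ?case
    using B'(1) Suc.IH[OF A'(2) B'(2)] by auto
qed

end

theory Submission
  imports Defs
begin

text \<open>
  By Kuratowski, a set of size \<open>\<aleph>\<^sub>n\<close> carries a map \<open>F\<close> from finite sets to finite sets such that
  every \<open>(n + 2)\<close>-element set \<open>s\<close> has a point \<open>p \<in> F (s - {p})\<close>. Fix a well-order of the space, and
  disjoint neighbourhoods of the points of each finite set. An \<open>(n + 2)\<close>-set \<open>s\<close> with largest
  element \<open>z\<close> and \<open>t = s - {z}\<close> steps to \<open>t \<union> {p}\<close> if \<open>z\<close> lies in the neighbourhood of
  \<open>p \<in> F t - t\<close> chosen for the finite set \<open>F t \<union> t\<close>. The colour of \<open>s\<close> is the number of steps
  that can be made from \<open>s\<close>.

  Given a copy of the rationals, pass to a dense-in-itself subset \<open>A\<close> inside the shortest possible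
  initial segment of the well-order. Then every neighbourhood of a point of \<open>A\<close> contains elements
  of \<open>A\<close> beyond any given one, so for any \<open>s \<subseteq> A\<close> one can pick \<open>p \<in> F (s - {p})\<close> and then replace
  \<open>p\<close> by a larger element of \<open>A\<close> very close to it; the new set steps to \<open>s\<close>, so its colour is one
  more.
\<close>

section \<open>Kuratowski's set mappings on sets of size \<open>\<aleph>\<^sub>n\<close>\<close>

text \<open>Induction on \<open>n\<close>. In a countable set, of two points the one with the
  smaller code is put into \<open>F\<close> of the other. For the next aleph, the points below any
  \<open>b\<close> embed into a set \<open>B\<close> of the preceding size, and the mapping
  \<open>H\<close> on \<open>B\<close> is pulled back along these embeddings.\<close>

lemma aleph_set_mapping:
  assumes "has_card_aleph n A"
  shows "\<exists>F :: 'a set \<Rightarrow> 'a set. (\<forall>t. finite t \<longrightarrow> finite (F t) \<and> F t \<subseteq> A) \<and>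
    (\<forall>s\<subseteq>A. card s = n + 2 \<longrightarrow> (\<exists>p\<in>s. p \<in> F (s - {p})))"
  using assms
proof (induction n arbitrary: A)
  case 0
  then have "|A| \<le>o |UNIV :: nat set|"
    by (metis card_of_nat has_card_aleph.simps(1) ordIso_iff_ordLeq ordIso_symmetric ordIso_transitive)
  then obtain f :: "'a \<Rightarrow> nat" where f: "inj_on f A"
    using card_of_ordLeq[of A "UNIV :: nat set"] by auto
  define F where "F t = (\<Union>b\<in>t. {x \<in> A. f x \<le> f b})" for t
  have "finite {x \<in> A. f x \<le> k}" for k
    by (rule inj_on_finite[of f _ "{..k}"]) (use f in \<open>auto simp: inj_on_def\<close>)
  then have "\<forall>t. finite t \<longrightarrow> finite (F t) \<and> F t \<subseteq> A"
    unfolding F_def by auto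
  moreover have "\<exists>p\<in>s. p \<in> F (s - {p})" if s: "s \<subseteq> A" "card s = 0 + 2" for s
  proof -
    obtain x y where xy: "s = {x, y}" "x \<noteq> y"
      using s(2) by (metis add_0 card_2_iff)
    then have "s - {x} = {y}" "s - {y} = {x}" "x \<in> A" "y \<in> A"
      using s(1) by auto
    then have "f x \<le> f y \<Longrightarrow> x \<in> F (s - {x})" "f y \<le> f x \<Longrightarrow> y \<in> F (s - {y})"
      unfolding F_def by simp_all
    then show ?thesis
      using xy(1) nat_le_linear[of "f x" "f y"] by blast
  qed
  ultimately show ?case
    by blast
next
  case (Suc n)
  then obtain B where B: "B \<subseteq> A" "has_card_aleph n B" "|A| =o cardSuc |B|"
    by auto
  from Suc.IH[OF B(2)] obtain H :: "'a set \<Rightarrow> 'a set"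
    where H: "\<And>t. finite t \<Longrightarrow> finite (H t)"
      and H': "\<And>s. s \<subseteq> B \<Longrightarrow> card s = n + 2 \<Longrightarrow> \<exists>p\<in>s. p \<in> H (s - {p})"
    by blast
  let ?r = "|A|"
  \<comment> \<open>The well-order \<open>?r\<close> has the least possible type for
    \<open>A\<close>, so each proper initial segment is smaller than \<open>A\<close>, hence at most
    as large as \<open>B\<close>.\<close>
  have "\<exists>e. inj_on e (underS ?r a) \<and> e ` underS ?r a \<subseteq> B" if "a \<in> A" for a
  proof -
    have "|underS ?r a| <o ?r"
      using card_of_underS[OF card_of_Card_order[of A]] that by (simp add: Field_card_of)
    then have "|underS ?r a| <o cardSuc |B|"
      using B(3) by (rule ordLess_ordIso_trans)
    then have "|underS ?r a| \<le>o |B|"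
      by (simp add: cardSuc_ordLeq_ordLess card_of_Card_order)
    then show ?thesis
      by (simp add: card_of_ordLeq)
  qed
  then obtain e where e: "\<And>a. a \<in> A \<Longrightarrow> inj_on (e a) (underS ?r a)"
      "\<And>a. a \<in> A \<Longrightarrow> e a ` underS ?r a \<subseteq> B"
    by metis
  define F where "F t = (\<Union>b\<in>t \<inter> A. {x \<in> underS ?r b. e b x \<in> H (e b ` (t - {b}))})" for t
  have under: "underS ?r b \<subseteq> A" for b
    using Field_card_of[of A] by (auto simp: underS_def Field_def)
  have "finite {x \<in> underS ?r b. e b x \<in> H (e b ` (t - {b}))}" if "finite t" "b \<in> A" for t b
    by (rule inj_on_finite[of "e b" _ "H (e b ` (t - {b}))"])
      (use that e(1) H in \<open>auto simp: inj_on_def\<close>)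
  then have "\<forall>t. finite t \<longrightarrow> finite (F t) \<and> F t \<subseteq> A"
    unfolding F_def using under by auto
  moreover have "\<exists>p\<in>s. p \<in> F (s - {p})" if s: "s \<subseteq> A" "card s = Suc n + 2" for s
  proof -
    have fin: "finite s" "s \<noteq> {}"
      using s(2) card.infinite by fastforce+
    have wo: "well_order_on A ?r"
      by (rule card_of_well_order_on)
    have "\<exists>b\<in>s. \<forall>x\<in>s - {b}. x \<in> underS ?r b"
      using fin s(1)
    proof (induction s rule: finite_ne_induct)
      case (insert x S)
      then obtain b where b: "b \<in> S" "\<forall>y\<in>S - {b}. y \<in> underS ?r b"
        by auto
      have tot: "(x, b) \<in> ?r \<or> (b, x) \<in> ?r" and tr: "trans ?r" and as: "antisym ?r"
        using wo insert b(1)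
        by (auto simp: well_order_on_def linear_order_on_def partial_order_on_def
            preorder_on_def total_on_def)
      show ?case
      proof (cases "(x, b) \<in> ?r")
        case True
        then show ?thesis
          using b insert.hyps by (intro bexI[of _ b]) (auto simp: underS_def)
      next
        case False
        then have "\<forall>y\<in>insert x S - {x}. y \<in> underS ?r x"
          using tot b tr as insert.hyps(3) unfolding underS_def
          by (auto dest: transD antisymD)
        then show ?thesis
          by blast
      qed
    qed auto
    \<comment> \<open>The greatest element \<open>b\<close> of \<open>s\<close> serves as the index:
      the other \<open>n + 2\<close> points lie below it, and \<open>H\<close> applies to their
      images under \<open>e b\<close>.\<close>
    then obtain b where b: "b \<in> s" "s - {b} \<subseteq> underS ?r b"
      by blast
    have bA: "b \<in> A"
      using b(1) s(1) by auto
    have inj: "inj_on (e b) (s - {b})"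
      using e(1)[OF bA] b(2) by (rule inj_on_subset)
    have "card (e b ` (s - {b})) = n + 2"
      using card_image[OF inj] s(2) b(1) fin by simp
    moreover have "e b ` (s - {b}) \<subseteq> B"
      using e(2)[OF bA] b(2) by blast
    ultimately obtain p where p: "p \<in> s - {b}" "e b p \<in> H (e b ` (s - {b}) - {e b p})"
      using H' by blast
    \<comment> \<open>Injectivity lets \<open>p\<close> be removed before \<open>b\<close>, so that
      \<open>b\<close> is one of the indices in the union defining
      \<open>F (s - {p})\<close>.\<close>
    have "e b ` (s - {b}) - {e b p} = e b ` (s - {p} - {b})"
      using inj p(1) by (auto simp: inj_on_def)
    then have "p \<in> F (s - {p})"
      unfolding F_def using p b bA by auto
    then show ?thesis
      using p(1) by blast
  qed
  ultimately show ?case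
    by blast
qed

section \<open>Deterministic steps between finite sets\<close>

lemma Hausdorff_finite_disjoint_nbhds:
  assumes X: "Hausdorff_space X" and G: "finite G" "G \<subseteq> topspace X"
  shows "\<exists>N. (\<forall>x\<in>G. openin X (N x) \<and> x \<in> N x) \<and> (\<forall>x\<in>G. \<forall>y\<in>G. x \<noteq> y \<longrightarrow> N x \<inter> N y = {})"
proof -
  have "\<exists>U V. openin X U \<and> openin X V \<and> x \<in> U \<and> y \<in> V \<and> disjnt U V"
    if "x \<in> G" "y \<in> G" "x \<noteq> y" for x y
    using X G(2) that unfolding Hausdorff_space_def by blast
  then obtain U V where UV: "\<And>x y. x \<in> G \<Longrightarrow> y \<in> G \<Longrightarrow> x \<noteq> y \<Longrightarrow>
      openin X (U x y) \<and> openin X (V x y) \<and> x \<in> U x y \<and> y \<in> V x y \<and> U x y \<inter> V x y = {}"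
    unfolding disjnt_def by metis
  \<comment> \<open>The choices for \<open>(x, y)\<close> and \<open>(y, x)\<close> are unrelated,
    so both are intersected. The factor \<open>topspace X\<close> covers a one-point
    \<open>G\<close>, where the intersection is over the empty family.\<close>
  define N where "N x = topspace X \<inter> (\<Inter>y\<in>G - {x}. U x y \<inter> V y x)" for x
  have "openin X (N x) \<and> x \<in> N x" if "x \<in> G" for x
  proof
    show "openin X (N x)"
    proof (cases "G - {x} = {}")
      case False
      then have "openin X (\<Inter>y\<in>G - {x}. U x y \<inter> V y x)"
        using UV that G(1) by (intro openin_INT2) auto
      then show ?thesis
        unfolding N_def by blast
    qed (simp only: N_def, simp)
    show "x \<in> N x"
      unfolding N_def using UV that G(2) by auto
  qed
  moreover have "N x \<inter> N y = {}" if "x \<in> G" "y \<in> G" "x \<noteq> y" for x y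
    using UV[OF that] that unfolding N_def by auto
  ultimately show ?thesis
    by blast
qed

definition walk_step ::
  "('a \<Rightarrow> 'a \<Rightarrow> bool) \<Rightarrow> ('a set \<Rightarrow> 'a set) \<Rightarrow> ('a set \<Rightarrow> 'a \<Rightarrow> 'a set) \<Rightarrow> 'a set \<Rightarrow> 'a set \<Rightarrow> bool"
  where "walk_step lt G N s s' \<longleftrightarrow>
    (\<exists>z t p. s = insert z t \<and> (\<forall>y\<in>t. lt y z) \<and> p \<in> G t - t \<and> z \<in> N t p \<and> s' = insert p t)"

text \<open>A relation rather than a recursive function: the new point \<open>p\<close> of a step
  may be large in the order, so a walk may go on forever, and then its starting set has no
  length.\<close>

inductive walk_length ::
  "('a \<Rightarrow> 'a \<Rightarrow> bool) \<Rightarrow> ('a set \<Rightarrow> 'a set) \<Rightarrow> ('a set \<Rightarrow> 'a \<Rightarrow> 'a set) \<Rightarrow> 'a set \<Rightarrow> nat \<Rightarrow> bool"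
  for lt G N where
  stop: "\<forall>s'. \<not> walk_step lt G N s s' \<Longrightarrow> walk_length lt G N s 0"
| step: "walk_step lt G N s s' \<Longrightarrow> walk_length lt G N s' k \<Longrightarrow> walk_length lt G N s (Suc k)"

lemma insert_greatest_unique:
  assumes "asymp lt" "insert z t = insert z' t'" "\<forall>y\<in>t. lt y z" "\<forall>y\<in>t'. lt y z'"
  shows "z = z' \<and> t = t'"
proof -
  have "z = z'"
    using assms by (metis asympD insert_iff)
  moreover have "z \<notin> t" "z' \<notin> t'"
    using assms by (metis asympD)+
  ultimately show ?thesis
    using assms(2) by auto
qed

text \<open>The greatest element of \<open>s\<close> determines \<open>z\<close> and
  \<open>t\<close>; disjointness of the neighbourhoods then determines \<open>p\<close>.\<close>

lemma walk_step_unique: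
  assumes lt: "asymp lt"
    and disj: "\<And>t x y. \<lbrakk>x \<in> G t; y \<in> G t; x \<noteq> y; finite t; t \<subseteq> S\<rbrakk> \<Longrightarrow> N t x \<inter> N t y = {}"
    and s: "finite s" "s \<subseteq> S"
    and step: "walk_step lt G N s s'" "walk_step lt G N s s''"
  shows "s' = s''"
proof -
  from step obtain z t p z' t' p' where 1: "s = insert z t" "\<forall>y\<in>t. lt y z" "p \<in> G t - t"
      "z \<in> N t p" "s' = insert p t"
    and 2: "s = insert z' t'" "\<forall>y\<in>t'. lt y z'" "p' \<in> G t' - t'" "z' \<in> N t' p'" "s'' = insert p' t'"
    unfolding walk_step_def by blast
  have eq: "z = z'" "t = t'"
    using insert_greatest_unique[OF lt 1(1)[symmetric, THEN trans, OF 2(1)] 1(2) 2(2)] by auto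
  have "finite t" "t \<subseteq> S"
    using s unfolding 1(1) by auto
  then have "p = p'"
    using disj[of p t p'] 1(3,4) 2(3,4) unfolding eq by blast
  then show ?thesis
    unfolding 1(5) 2(5) eq by simp
qed

text \<open>Two walks from \<open>s\<close> agree step by step. \<open>GS\<close> keeps all their
  sets inside \<open>S\<close>, where \<open>disj\<close> applies.\<close>

lemma walk_length_unique:
  assumes lt: "asymp lt"
    and disj: "\<And>t x y. \<lbrakk>x \<in> G t; y \<in> G t; x \<noteq> y; finite t; t \<subseteq> S\<rbrakk> \<Longrightarrow> N t x \<inter> N t y = {}"
    and GS: "\<And>t. \<lbrakk>finite t; t \<subseteq> S\<rbrakk> \<Longrightarrow> G t \<subseteq> S"
    and "walk_length lt G N s k" "walk_length lt G N s l" "finite s" "s \<subseteq> S"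
  shows "k = l"
  using assms(4-)
proof (induction arbitrary: l rule: walk_length.induct)
  case (stop s)
  then show ?case
    by (auto elim: walk_length.cases)
next
  case (step s s' k)
  from step.prems(1) step.hyps(1) obtain s'' l' where
    l: "l = Suc l'" "walk_step lt G N s s''" "walk_length lt G N s'' l'"
    by (auto elim: walk_length.cases)
  have "s'' = s'"
    using walk_step_unique[OF lt disj step.prems(2,3) l(2) step.hyps(1)] by blast
  moreover have "finite s' \<and> s' \<subseteq> S"
  proof -
    from step.hyps(1) obtain z t p where *: "s = insert z t" "p \<in> G t" "s' = insert p t"
      unfolding walk_step_def by blast
    then have "finite t" "t \<subseteq> S"
      using step.prems(2,3) by auto
    then show ?thesis
      using GS[of t] *(2,3) by auto
  qed
  ultimately show ?case
    using step.IH l by blast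
qed

section \<open>Dense-in-itself subsets and the well-order\<close>

text \<open>Take \<open>A\<close> below the least possible strict bound, or \<open>A = R\<close> if
  no nonempty dense-in-itself subset of \<open>R\<close> is bounded. If nothing in
  \<open>A \<inter> U\<close> were beyond \<open>y\<close>, an open piece of \<open>A\<close> would
  be such a subset strictly below \<open>y\<close>, against minimality.\<close>

lemma dense_in_itself_unbounded_subset:
  assumes lt: "wfp lt" "totalp lt" and X: "t1_space X"
    and R: "R \<noteq> {}" "R \<subseteq> X derived_set_of R"
  obtains A where "A \<subseteq> R" "A \<noteq> {}"
    "\<And>p U y. \<lbrakk>p \<in> A; openin X U; p \<in> U; y \<in> A\<rbrakk> \<Longrightarrow> \<exists>z\<in>A \<inter> U. lt y z"
proof -
  define P where "P A \<longleftrightarrow> A \<subseteq> R \<and> A \<noteq> {} \<and> A \<subseteq> X derived_set_of A" for A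
  have unb: "\<exists>z\<in>A \<inter> U. lt y z"
    if A: "P A" and min: "\<And>B. P B \<Longrightarrow> \<not> (\<forall>b\<in>B. lt b y)"
      and pU: "p \<in> A" "openin X U" "p \<in> U" for A p U y
  proof (rule ccontr)
    assume *: "\<not> ?thesis"
    \<comment> \<open>Totality only makes \<open>y\<close> a weak bound of
      \<open>A \<inter> U\<close>; deleting \<open>y\<close> makes it strict, and in a T1 space this
      leaves an open part of \<open>A\<close>.\<close>
    define B where "B = A \<inter> U - {y}"
    have "B \<subseteq> X derived_set_of B"
    proof
      fix b assume b: "b \<in> B"
      have bA: "b \<in> X derived_set_of A"
        using b A unfolding B_def P_def by auto
      show "b \<in> X derived_set_of B"
        unfolding in_derived_set_of
      proof (intro conjI allI impI)
        show "b \<in> topspace X"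
          using bA by (simp add: in_derived_set_of)
        fix T assume T: "b \<in> T \<and> openin X T"
        have "openin X (T \<inter> U - {y})"
          using T pU(2) X by (metis openin_Int t1_space_openin_delete_alt)
        moreover have "b \<in> T \<inter> U - {y}"
          using b T unfolding B_def by auto
        ultimately obtain x where "x \<noteq> b" "x \<in> A" "x \<in> T \<inter> U - {y}"
          using bA unfolding in_derived_set_of by (elim conjE allE[of _ "T \<inter> U - {y}"]) auto
        then show "\<exists>x. x \<noteq> b \<and> x \<in> B \<and> x \<in> T"
          unfolding B_def by auto
      qed
    qed
    moreover have "B \<noteq> {}"
    proof -
      have "p \<in> X derived_set_of A"
        using A pU(1) unfolding P_def by auto
      then obtain q where "q \<noteq> p" "q \<in> A" "q \<in> U"
        using pU by (auto simp: in_derived_set_of)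
      then show ?thesis
        unfolding B_def using pU by blast
    qed
    ultimately have "P B"
      using A unfolding P_def B_def by auto
    moreover have "\<forall>b\<in>B. lt b y"
      using * lt(2) unfolding B_def by (auto dest: totalpD)
    ultimately show False
      using min by blast
  qed
  show ?thesis
  proof (cases "\<exists>x A. P A \<and> (\<forall>a\<in>A. lt a x)")
    case False
    then have "\<not> (\<forall>b\<in>B. lt b y)" if "P B" for B y
      using that by blast
    moreover have "P R"
      using R unfolding P_def by blast
    ultimately have "\<exists>z\<in>R \<inter> U. lt y z" if "p \<in> R" "openin X U" "p \<in> U" for p U y
      using unb[OF _ _ that] by blast
    then show ?thesis
      using that[of R] R(1) by blast
  next
    case True
    then obtain x where x: "\<exists>A. P A \<and> (\<forall>a\<in>A. lt a x)"
      and min: "\<And>y. lt y x \<Longrightarrow> \<not> (\<exists>A. P A \<and> (\<forall>a\<in>A. lt a y))"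
      using wfp_induct_rule[OF lt(1), of "\<lambda>x. \<not> (\<exists>A. P A \<and> (\<forall>a\<in>A. lt a x))"] by blast
    from x obtain A where A: "P A" "\<forall>a\<in>A. lt a x"
      by blast
    have "\<exists>z\<in>A \<inter> U. lt y z" if "p \<in> A" "openin X U" "p \<in> U" "y \<in> A" for p U y
    proof (rule unb[OF A(1) _ that(1-3)])
      show "\<not> (\<forall>b\<in>B. lt b y)" if "P B" for B
        using min[of y] A(2) \<open>y \<in> A\<close> that by blast
    qed
    moreover have "A \<subseteq> R" "A \<noteq> {}"
      using A(1) unfolding P_def by blast+
    ultimately show ?thesis
      using that[of A] by blast
  qed
qed

lemma finite_has_greatest:
  assumes "transp lt" "totalp lt" "finite t" "t \<noteq> {}"
  shows "\<exists>m\<in>t. \<forall>y\<in>t. y = m \<or> lt y m"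
  using assms(3,4)
proof (induction rule: finite_ne_induct)
  case (insert x S)
  then obtain m where m: "m \<in> S" "\<forall>y\<in>S. y = m \<or> lt y m"
    by blast
  show ?case
  proof (cases "lt m x")
    case True
    then have "\<forall>y\<in>insert x S. y = x \<or> lt y x"
      using m assms(1) by (auto dest: transpD)
    then show ?thesis
      by blast
  next
    case False
    then have "x = m \<or> lt x m"
      using assms(2) by (auto dest: totalpD)
    then show ?thesis
      using m by blast
  qed
qed auto

text \<open>Every rational is a limit point of the rationals. The homeomorphism carries this to the
  subspace \<open>R\<close>, whose limit points are limit points in \<open>X\<close>.\<close>

lemma rationals_copy_dense_in_itself:
  assumes "subtopology X R homeomorphic_space top_of_set (\<rat> :: real set)" "R \<subseteq> topspace X"
  shows "R \<noteq> {} \<and> R \<subseteq> X derived_set_of R"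
proof -
  have top: "topspace (subtopology X R) = R"
    using assms(2) by auto
  from assms(1) obtain f where f: "homeomorphic_map (top_of_set (\<rat> :: real set)) (subtopology X R) f"
    using homeomorphic_space homeomorphic_space_sym by blast
  have R: "f ` \<rat> = R"
    using homeomorphic_imp_surjective_map[OF f] top by simp
  have "x islimpt \<rat>" for x :: real
    using limpt_of_closure[of x \<rat>] islimpt_UNIV[of x] by (simp add: Rats_closure_real)
  then have "(top_of_set (\<rat> :: real set)) derived_set_of \<rat> = \<rat>"
    by (auto simp: derived_set_of_subtopology in_derived_set_of islimpt_def) blast
  then have "(subtopology X R) derived_set_of R = R"
    using homeomorphic_map_derived_set_of[OF f, of \<rat>] R by simp
  then show ?thesis
    using R Rats_0 by (auto simp: derived_set_of_subtopology)
qed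

section \<open>The colouring and its values on a copy of the rationals\<close>

theorem theorem3p3:
  fixes n :: nat and X :: "'a topology"
  assumes "Hausdorff_space X"
    and "has_card_aleph n (topspace X)"
  shows "\<exists>c :: 'a set \<Rightarrow> nat. \<forall>R. R \<subseteq> topspace X \<longrightarrow>
    subtopology X R homeomorphic_space top_of_set (\<rat> :: real set) \<longrightarrow>
    c ` [R]\<^bsup>(n + 2)\<^esup> = UNIV"
proof -
  let ?S = "topspace X"
  obtain F where F: "\<And>t. finite t \<Longrightarrow> finite (F t)" "\<And>t. finite t \<Longrightarrow> F t \<subseteq> ?S"
    and FK: "\<And>s. s \<subseteq> ?S \<Longrightarrow> card s = n + 2 \<Longrightarrow> \<exists>p\<in>s. p \<in> F (s - {p})"
    using aleph_set_mapping[OF assms(2)] by blast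
  \<comment> \<open>Including \<open>t\<close> gives its own points neighbourhoods disjoint from
    those that trigger a step, which makes stopping possible.\<close>
  define G where "G t = F t \<union> t" for t
  have G: "finite (G t)" "G t \<subseteq> ?S" if "finite t" "t \<subseteq> ?S" for t
    using F that by (auto simp: G_def)
  have "\<exists>N. (\<forall>x\<in>G t. openin X (N x) \<and> x \<in> N x) \<and>
      (\<forall>x\<in>G t. \<forall>y\<in>G t. x \<noteq> y \<longrightarrow> N x \<inter> N y = {})" if "finite t" "t \<subseteq> ?S" for t
    using Hausdorff_finite_disjoint_nbhds[OF assms(1) G[OF that]] .
  then obtain N where N: "\<And>t x. \<lbrakk>x \<in> G t; finite t; t \<subseteq> ?S\<rbrakk> \<Longrightarrow> openin X (N t x) \<and> x \<in> N t x"
    and disj: "\<And>t x y. \<lbrakk>x \<in> G t; y \<in> G t; x \<noteq> y; finite t; t \<subseteq> ?S\<rbrakk> \<Longrightarrow> N t x \<inter> N t y = {}"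
    by metis
  obtain r :: "'a rel" where r: "well_order_on UNIV r"
    using well_order_on by blast
  define lt where "lt x y \<longleftrightarrow> (x, y) \<in> r - Id" for x y
  have lt: "wfp lt" "totalp lt" "transp lt" "asymp lt"
  proof -
    have "{(x, y). lt x y} = r - Id"
      by (auto simp: lt_def)
    then show "wfp lt"
      using r unfolding well_order_on_def wfp_def by simp
    then show "asymp lt"
      by (rule wfp_imp_asymp)
    show "totalp lt" "transp lt"
      using r unfolding well_order_on_def linear_order_on_def partial_order_on_def preorder_on_def
      by (auto simp: lt_def total_on_def totalp_on_def intro!: transpI dest: transD antisymD)
  qed
  \<comment> \<open>On sets whose walk never stops this is an unspecified number; the colours below
    are all obtained from sets with a known walk length.\<close>
  define c where "c s = (THE k. walk_length lt G N s k)" for s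
  have c: "c s = k" if "walk_length lt G N s k" "finite s" "s \<subseteq> ?S" for s k
    unfolding c_def using that(1)
  proof (rule the_equality)
    show "l = k" if "walk_length lt G N s l" for l
      by (rule walk_length_unique[OF lt(4) disj G(2) that \<open>walk_length lt G N s k\<close>
            \<open>finite s\<close> \<open>s \<subseteq> ?S\<close>])
  qed
  have "c ` [R]\<^bsup>(n + 2)\<^esup> = UNIV"
    if R: "R \<subseteq> ?S" "subtopology X R homeomorphic_space top_of_set (\<rat> :: real set)" for R
  proof -
    obtain A where A: "A \<subseteq> R" "A \<noteq> {}"
      and unb: "\<And>p U y. \<lbrakk>p \<in> A; openin X U; p \<in> U; y \<in> A\<rbrakk> \<Longrightarrow> \<exists>z\<in>A \<inter> U. lt y z"
      using dense_in_itself_unbounded_subset[OF lt(1,2) Hausdorff_imp_t1_space[OF assms(1)]]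
        rationals_copy_dense_in_itself[OF R(2,1)] by metis
    have above: "\<exists>z\<in>A \<inter> U. \<forall>y\<in>t. lt y z"
      if pU: "p \<in> A" "openin X U" "p \<in> U" and t: "finite t" "t \<noteq> {}" "t \<subseteq> A" for p U t
    proof -
      obtain m where m: "m \<in> t" "\<forall>y\<in>t. y = m \<or> lt y m"
        using finite_has_greatest[OF lt(3,2) t(1,2)] by blast
      then obtain z where z: "z \<in> A \<inter> U" "lt m z"
        using unb[of p U m] pU t(3) by blast
      then have "\<forall>y\<in>t. lt y z"
        using m(2) lt(3) by (auto dest: transpD)
      then show ?thesis
        using z(1) by blast
    qed
    have not_in: "z \<notin> t" if "\<forall>y\<in>t. lt y z" for z t
      using that lt(4) by (auto dest: asympD)
    have AS: "A \<subseteq> ?S"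
      using A(1) R(1) by blast
    obtain a where a: "a \<in> A"
      using A(2) by blast
    have "\<exists>t. finite t \<and> t \<subseteq> A \<and> card t = Suc k" for k
    proof (induction k)
      case 0
      show ?case
        using a by (intro exI[of _ "{a}"]) auto
    next
      case (Suc k)
      then obtain t where t: "finite t" "t \<subseteq> A" "card t = Suc k"
        by blast
      then obtain z where "z \<in> A" "\<forall>y\<in>t. lt y z"
        using above[of a ?S t] a AS by force
      then show ?case
        using t not_in by (intro exI[of _ "insert z t"]) auto
    qed
    then obtain t where t: "finite t" "t \<subseteq> A" "card t = Suc n"
      by blast
    have "\<exists>s. finite s \<and> s \<subseteq> A \<and> card s = n + 2 \<and> walk_length lt G N s k" for k
    proof (induction k)
      \<comment> \<open>Colour 0: \<open>z\<close> is chosen beyond \<open>t\<close> and near a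
        point \<open>b\<close> of \<open>t\<close> itself, hence outside the neighbourhood of every
        point of \<open>G t - t\<close>.\<close>
      case 0
      from t obtain b where b: "b \<in> t"
        by fastforce
      have Nb: "openin X (N t b)" "b \<in> N t b"
        using N[of b t] b t AS by (auto simp: G_def)
      then obtain z where z: "z \<in> A" "z \<in> N t b" "\<forall>y\<in>t. lt y z"
        using above[of b "N t b" t] b t by blast
      have "\<not> walk_step lt G N (insert z t) s'" for s'
      proof
        assume "walk_step lt G N (insert z t) s'"
        then obtain z' t' p where *: "insert z t = insert z' t'" "\<forall>y\<in>t'. lt y z'"
            "p \<in> G t' - t'" "z' \<in> N t' p"
          unfolding walk_step_def by blast
        have "z = z'" "t = t'"
          using insert_greatest_unique[OF lt(4) *(1) z(3) *(2)] by auto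
        then show False
          using disj[of p t b] * z b t AS by (auto simp: G_def)
      qed
      then show ?case
        using z t not_in by (intro exI[of _ "insert z t"]) (auto intro: walk_length.stop)
    next
      case (Suc k)
      then obtain s where s: "finite s" "s \<subseteq> A" "card s = n + 2" "walk_length lt G N s k"
        by blast
      then obtain p where p: "p \<in> s" "p \<in> F (s - {p})"
        using FK[of s] AS by auto
      let ?t = "s - {p}"
      have "card ?t = Suc n"
        using s p by simp
      have t': "finite ?t" "?t \<subseteq> A"
        using s by auto
      have pG: "p \<in> G ?t"
        using p by (simp add: G_def)
      then have "openin X (N ?t p)" "p \<in> N ?t p"
        using N[of p ?t] t' AS by auto
      \<comment> \<open>Taking \<open>z\<close> beyond all of \<open>s\<close> makes it the greatest
        element of the new set and keeps the size at \<open>n + 2\<close>; its step puts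
        \<open>p\<close> back.\<close>
      then obtain z where z: "z \<in> A" "z \<in> N ?t p" "\<forall>y\<in>s. lt y z"
        using above[of p "N ?t p" s] p s by blast
      have "walk_step lt G N (insert z ?t) s"
        unfolding walk_step_def using z p pG
        by (intro exI[of _ z] exI[of _ ?t] exI[of _ p]) auto
      then have "walk_length lt G N (insert z ?t) (Suc k)"
        using s(4) by (rule walk_length.step)
      moreover have "card (insert z ?t) = n + 2"
        using not_in[OF z(3)] t'(1) \<open>card ?t = Suc n\<close> by simp
      ultimately show ?case
        using z(1) t' by (intro exI[of _ "insert z ?t"]) auto
    qed
    then have "k \<in> c ` [R]\<^bsup>(n + 2)\<^esup>" for k
      using c A(1) R(1) unfolding nsets_def by (smt (verit) image_iff mem_Collect_eq subset_trans)
    then show ?thesis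
      by blast
  qed
  then show ?thesis
    by blast
qed

end
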